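(* Let $C$ be an $n$-separable necklace with $n$ colors, each color having an odd number of points. Then 2-Thief-Necklace-Splitting on $C$ has a unique solution.
   Context: A necklace is a set $C$ of pairwise disjoint finite nonempty subsets of $\mathbb{R}$ (called colors). A necklace $C$ is $k$-separable if for every $A\subseteq C$ there exist real numbers $s_1<\dots<s_k$ such that, labelling the intervals $(-\infty,s_1],[s_1,s_2],\dots,[s_{k-1},s_k],[s_k,\infty)$ alternately $A,\bar A,A,\dots$, every interval labelled $A$ is disjoint from $\bigcup_{c\in C\setminus A}c$ and every interval labelled $\bar A$ is disjoint from $\bigcup_{c\in A}c$. A solution to 2-Thief-Necklace-Splitting on a necklace $C$ with $n$ colors is a set of $n$ split points $q_1<\dots<q_n$ in $\mathbb{R}$ such that, labelling the open intervals $(-\infty,q_1),(q_1,q_2),\dots,(q_n,\infty)$ alternately $A^+$ and $A^-$, for every color $c$ the union of the intervals labelled $A^+$ contains the same number of points of $c$ as the union of the intervals labelled $A^-$. *)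

theory Defs
  imports Complex_Main
begin

definition necklace :: "real set set \<Rightarrow> bool" where
  "necklace C \<longleftrightarrow> pairwise disjnt C \<and> (\<forall>c\<in>C. finite c \<and> c \<noteq> {})"

text \<open>
  A strictly increasing list \<open>s\<close> of length \<open>k\<close> cuts the line into the intervals with indices
  \<open>0, \<dots>, k\<close>; those with index \<open>0\<close> and \<open>k\<close> are unbounded on the left and on the right, respectively.
\<close>

definition closed_piece :: "real list \<Rightarrow> nat \<Rightarrow> real set" where
  "closed_piece s i =
     {x. (0 < i \<longrightarrow> s ! (i - 1) \<le> x) \<and> (i < length s \<longrightarrow> x \<le> s ! i)}"

definition open_piece :: "real list \<Rightarrow> nat \<Rightarrow> real set" where
  "open_piece s i =
     {x. (0 < i \<longrightarrow> s ! (i - 1) < x) \<and> (i < length s \<longrightarrow> x < s ! i)}"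

text \<open>The leftmost interval is labelled \<open>A\<close>, so the intervals labelled \<open>A\<close> are those of even index.\<close>

definition separable :: "nat \<Rightarrow> real set set \<Rightarrow> bool" where
  "separable k C \<longleftrightarrow>
     (\<forall>A\<subseteq>C. \<exists>s. length s = k \<and> sorted_wrt (<) s \<and>
        (\<forall>i\<le>k. (even i \<longrightarrow> closed_piece s i \<inter> \<Union>(C - A) = {}) \<and>
               (odd i \<longrightarrow> closed_piece s i \<inter> \<Union>A = {})))"

definition positive_part :: "real list \<Rightarrow> real set" where
  "positive_part q = (\<Union>i\<in>{i. i \<le> length q \<and> even i}. open_piece q i)"

definition negative_part :: "real list \<Rightarrow> real set" where
  "negative_part q = (\<Union>i\<in>{i. i \<le> length q \<and> odd i}. open_piece q i)"

definition splitting_solution :: "real set set \<Rightarrow> real set \<Rightarrow> bool" where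
  "splitting_solution C Q \<longleftrightarrow>
     (\<exists>q. length q = card C \<and> sorted_wrt (<) q \<and> Q = set q \<and>
        (\<forall>c\<in>C. card (c \<inter> positive_part q) = card (c \<inter> negative_part q)))"

end

theory Submission
  imports Defs "Jordan_Normal_Form.Determinant" "HOL-Library.FuncSet"
begin

text \<open>
  A solution meets every colour in an odd number of points, hence in exactly one: it is a transversal
  \<open>p\<close> of the colours. Let \<open>f\<^sub>p(x)\<close> be the determinant whose rows are the points of the
  moment curve of degree \<open>n\<close> at \<open>p\<^sub>0, \<dots>, p\<^sub>n\<^sub>-\<^sub>1\<close> (in the order of the colours) and at
  \<open>x\<close>; it is a nonzero multiple of \<open>\<Prod>\<^sub>i (x - p\<^sub>i)\<close>. The map sending \<open>p\<close> to the numbers of points of each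
  colour at which \<open>f\<^sub>p > 0\<close> takes values in \<open>\<Prod>\<^sub>i {0, \<dots>, |c\<^sub>i| - 1}\<close>, a set with as many elements as there
  are transversals. So injectivity of this map implies bijectivity, and the solutions are the preimages
  of the vector with entries \<open>(|c\<^sub>i| - 1) / 2\<close>.

  For injectivity, suppose \<open>p \<noteq> q\<close> have the same counts. Then every \<open>(1 - t) f\<^sub>p - t f\<^sub>q\<close> is annihilated by
  some convex combination of evaluations at points of \<open>c\<^sub>i\<close>, for each \<open>i\<close>. By \<open>n\<close>-separability, such
  combinations, one for each colour, are linearly independent functionals on polynomials of degree
  at most \<open>n\<close>, so the determinant comparing their orientation with \<open>(1 - t) f\<^sub>p - t f\<^sub>q\<close> never vanishes on \<open>[0, 1]\<close>.
  But it is positive at \<open>t = 0\<close> and negative at \<open>t = 1\<close>.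
\<close>

section \<open>Pieces and signs of products\<close>

lemma open_piece_sign:
  assumes "sorted_wrt (<) s" "k \<le> length s" "x \<in> open_piece s k"
  shows "0 < (- 1) ^ k * (\<Prod>y\<in>set s. y - x)"
proof -
  have below: "s ! i < x" if "i < k" for i
  proof -
    have "s ! i \<le> s ! (k - 1)"
      using that assms(1,2) by (cases "i = k - 1") (auto simp: sorted_wrt_iff_nth_less less_imp_le)
    with assms(3) that show ?thesis by (auto simp: open_piece_def)
  qed
  have above: "x < s ! i" if "k \<le> i" "i < length s" for i
  proof -
    have "s ! k \<le> s ! i"
      using that assms(1) by (cases "i = k") (auto simp: sorted_wrt_iff_nth_less less_imp_le)
    with assms(3) that show ?thesis by (auto simp: open_piece_def)
  qed
  have "distinct s" using assms(1) by (simp add: strict_sorted_iff)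
  then have "bij_betw ((!) s) {..<length s} (set s)"
    by (rule bij_betw_nth) auto
  then have "(\<Prod>y\<in>set s. y - x) = (\<Prod>i<length s. s ! i - x)"
    by (simp add: prod.reindex_bij_betw[symmetric])
  also have "{..<length s} = {..<k} \<union> {k..<length s}"
    using assms(2) by auto
  also have "(\<Prod>i\<in>\<dots>. s ! i - x) = (\<Prod>i<k. s ! i - x) * (\<Prod>i=k..<length s. s ! i - x)"
    by (rule prod.union_disjoint) auto
  also have "(\<Prod>i<k. s ! i - x) = (\<Prod>i<k. (- 1) * (x - s ! i))"
    by simp
  also have "\<dots> = (- 1) ^ k * (\<Prod>i<k. x - s ! i)"
    by (subst prod.distrib) simp
  finally have "(- 1) ^ k * (\<Prod>y\<in>set s. y - x) =
      (\<Prod>i<k. x - s ! i) * (\<Prod>i=k..<length s. s ! i - x)"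
    by (simp add: mult.assoc[symmetric] power_mult_distrib[symmetric])
  also have "\<dots> > 0"
    using below above by (intro mult_pos_pos prod_pos) auto
  finally show ?thesis .
qed

lemma ex_open_piece:
  assumes "sorted_wrt (<) s" "x \<notin> set s"
  shows "\<exists>k\<le>length s. x \<in> open_piece s k"
proof -
  define k where "k = (LEAST k. k = length s \<or> x < s ! k)"
  have k: "k = length s \<or> x < s ! k"
    unfolding k_def by (rule LeastI[of _ "length s"]) simp
  have least: "k \<le> j" if "j = length s \<or> x < s ! j" for j
    unfolding k_def using that by (rule Least_le)
  have "k \<le> length s" by (rule least) simp
  moreover have "s ! (k - 1) < x" if "0 < k"
  proof -
    have "\<not> (k - 1 = length s \<or> x < s ! (k - 1))"
      using least[of "k - 1"] that by linarith
    moreover have "s ! (k - 1) \<in> set s"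
      using that \<open>k \<le> length s\<close> by simp
    ultimately show ?thesis using assms(2) by (metis linorder_neqE_linordered_idom)
  qed
  ultimately show ?thesis
    using k by (intro exI[of _ k]) (auto simp: open_piece_def)
qed

lemma prod_diff_eq_0:
  fixes S :: "real set"
  shows "finite S \<Longrightarrow> x \<in> S \<Longrightarrow> (\<Prod>y\<in>S. y - x) = 0"
  by (rule prod_zero) auto

lemma not_in_set_if_open_piece:
  assumes "sorted_wrt (<) s" "k \<le> length s" "x \<in> open_piece s k"
  shows "x \<notin> set s"
  using open_piece_sign[OF assms] by (auto simp: prod_diff_eq_0)

lemma positive_part_eq:
  assumes "sorted_wrt (<) q"
  shows "positive_part q = {x. 0 < (\<Prod>y\<in>set q. y - x)}"
proof (rule Set.set_eqI)
  fix x
  show "x \<in> positive_part q \<longleftrightarrow> x \<in> {x. 0 < (\<Prod>y\<in>set q. y - x)}"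
  proof (cases "x \<in> set q")
    case True
    then show ?thesis
      using not_in_set_if_open_piece[OF assms] by (auto simp: positive_part_def prod_diff_eq_0)
  next
    case False
    then obtain k where k: "k \<le> length q" "x \<in> open_piece q k"
      using ex_open_piece[OF assms] by blast
    show ?thesis
    proof (cases "even k")
      case True
      then show ?thesis using k open_piece_sign[OF assms k] by (auto simp: positive_part_def)
    next
      case odd: False
      have "odd j" if "j \<le> length q" "x \<in> open_piece q j" for j
        using open_piece_sign[OF assms that] open_piece_sign[OF assms k] odd by (auto elim!: evenE)
      then show ?thesis using odd open_piece_sign[OF assms k] by (auto simp: positive_part_def)
    qed
  qed
qed

lemma negative_part_eq:
  assumes "sorted_wrt (<) q"
  shows "negative_part q = {x. (\<Prod>y\<in>set q. y - x) < 0}"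
proof (rule Set.set_eqI)
  fix x
  show "x \<in> negative_part q \<longleftrightarrow> x \<in> {x. (\<Prod>y\<in>set q. y - x) < 0}"
  proof (cases "x \<in> set q")
    case True
    then show ?thesis
      using not_in_set_if_open_piece[OF assms] by (auto simp: negative_part_def prod_diff_eq_0)
  next
    case False
    then obtain k where k: "k \<le> length q" "x \<in> open_piece q k"
      using ex_open_piece[OF assms] by blast
    show ?thesis
    proof (cases "odd k")
      case True
      then show ?thesis using k open_piece_sign[OF assms k] by (auto simp: negative_part_def)
    next
      case even: False
      have "even j" if "j \<le> length q" "x \<in> open_piece q j" for j
        using open_piece_sign[OF assms that] open_piece_sign[OF assms k] even by (cases "even j") auto
      then show ?thesis using even open_piece_sign[OF assms k] by (auto simp: negative_part_def)
    qed
  qed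
qed

lemma splitting_solution_iff:
  "splitting_solution C Q \<longleftrightarrow> finite Q \<and> card Q = card C \<and>
     (\<forall>c\<in>C. card {x\<in>c. 0 < (\<Prod>y\<in>Q. y - x)} = card {x\<in>c. (\<Prod>y\<in>Q. y - x) < 0})"
  (is "_ \<longleftrightarrow> ?R")
proof
  assume "splitting_solution C Q"
  then obtain q where q: "length q = card C" "sorted_wrt (<) q" "Q = set q"
    "\<forall>c\<in>C. card (c \<inter> positive_part q) = card (c \<inter> negative_part q)"
    unfolding splitting_solution_def by blast
  then show ?R
    by (auto simp: positive_part_eq negative_part_eq Collect_conj_eq strict_sorted_iff distinct_card)
next
  assume R: ?R
  define q where "q = sorted_list_of_set Q"
  have "sorted_wrt (<) q" "set q = Q" "length q = card C"
    using R by (auto simp: q_def)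
  with R show "splitting_solution C Q"
    unfolding splitting_solution_def
    by (intro exI[of _ q]) (auto simp: positive_part_eq negative_part_eq Collect_conj_eq)
qed

lemma separable_imp_sign:
  assumes "separable k C" "A \<subseteq> C"
  obtains S where "finite S" "card S = k"
    "\<forall>x\<in>\<Union>A. 0 < (\<Prod>y\<in>S. y - x)" "\<forall>x\<in>\<Union>(C - A). (\<Prod>y\<in>S. y - x) < 0"
proof -
  obtain s where s: "length s = k" "sorted_wrt (<) s"
    and pieces: "\<forall>i\<le>k. (even i \<longrightarrow> closed_piece s i \<inter> \<Union>(C - A) = {}) \<and>
               (odd i \<longrightarrow> closed_piece s i \<inter> \<Union>A = {})"
    using assms(1)[unfolded separable_def, rule_format, OF assms(2)] by (elim exE conjE)
  have even: "closed_piece s i \<inter> \<Union>(C - A) = {}" if "i \<le> k" "even i" for i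
    using pieces that by simp
  have odd: "closed_piece s i \<inter> \<Union>A = {}" if "i \<le> k" "odd i" for i
    using pieces that by simp
  have oc: "open_piece s i \<subseteq> closed_piece s i" for i
    by (auto simp: open_piece_def closed_piece_def)
  have touch: "x \<in> closed_piece s i \<and> x \<in> closed_piece s (Suc i)" if "i < k" "x = s ! i" for x i
  proof -
    have "s ! (i - 1) \<le> s ! i" if "0 < i"
      using s that \<open>i < k\<close> by (auto simp: sorted_wrt_iff_nth_less less_imp_le)
    moreover have "s ! i \<le> s ! Suc i" if "Suc i < k"
      using s that by (auto simp: sorted_wrt_iff_nth_less less_imp_le)
    ultimately show ?thesis using that s(1) by (auto simp: closed_piece_def)
  qed
  have A: "x \<in> \<Union>A \<Longrightarrow> x \<notin> set s" and B: "x \<in> \<Union>(C - A) \<Longrightarrow> x \<notin> set s" for x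
  proof -
    have *: "\<exists>i\<le>k. even i \<and> x \<in> closed_piece s i" "\<exists>i\<le>k. odd i \<and> x \<in> closed_piece s i"
      if x: "x \<in> set s"
    proof -
      obtain i where i: "i < k" "x = s ! i"
        using x s(1) by (auto simp: in_set_conv_nth)
      show "\<exists>i\<le>k. even i \<and> x \<in> closed_piece s i" "\<exists>i\<le>k. odd i \<and> x \<in> closed_piece s i"
        using touch[OF i] i(1) by (metis Suc_leI even_Suc less_imp_le)+
    qed
    show "x \<in> \<Union>A \<Longrightarrow> x \<notin> set s" using *(2) odd by blast
    show "x \<in> \<Union>(C - A) \<Longrightarrow> x \<notin> set s" using *(1) even by blast
  qed
  show thesis
  proof
    show "finite (set s)" by simp
    show "card (set s) = k" using s by (simp add: strict_sorted_iff distinct_card)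
    show "\<forall>x\<in>\<Union>A. 0 < (\<Prod>y\<in>set s. y - x)"
    proof
      fix x assume x: "x \<in> \<Union>A"
      obtain i where i: "i \<le> length s" "x \<in> open_piece s i"
        using ex_open_piece[OF s(2) A[OF x]] by blast
      have "even i" using odd[of i] oc[of i] i x s(1) by blast
      then show "0 < (\<Prod>y\<in>set s. y - x)" using open_piece_sign[OF s(2) i] by simp
    qed
    show "\<forall>x\<in>\<Union>(C - A). (\<Prod>y\<in>set s. y - x) < 0"
    proof
      fix x assume x: "x \<in> \<Union>(C - A)"
      obtain i where i: "i \<le> length s" "x \<in> open_piece s i"
        using ex_open_piece[OF s(2) B[OF x]] by blast
      have "odd i" using even[of i] oc[of i] i x s(1) by blast
      then show "(\<Prod>y\<in>set s. y - x) < 0" using open_piece_sign[OF s(2) i] by simp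
    qed
  qed
qed

section \<open>Polynomials of bounded degree as coefficient vectors\<close>

definition pval :: "nat \<Rightarrow> (nat \<Rightarrow> real) \<Rightarrow> real \<Rightarrow> real" where
  "pval n a x = (\<Sum>j\<le>n. a j * x ^ j)"

lemma pval_coeff: "Polynomial.degree p \<le> n \<Longrightarrow> pval n (Polynomial.coeff p) x = poly p x"
  unfolding pval_def poly_altdef
  by (rule sum.mono_neutral_right) (auto simp: coeff_eq_0)

lemma prod_linear_coeff:
  fixes S :: "real set"
  assumes "finite S"
  obtains a where "a (card S) = 1" "\<And>x. pval (card S) a x = (\<Prod>y\<in>S. x - y)"
proof -
  define q where "q = (\<Prod>y\<in>S. [:- y, 1:])"
  have deg: "Polynomial.degree q = card S"
    unfolding q_def by (subst degree_prod_eq_sum_degree) auto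
  have "Polynomial.coeff q (card S) = 1"
    using lead_coeff_prod[of "\<lambda>y. [:- y, 1:]" S] deg by (simp add: q_def)
  moreover have "pval (card S) (Polynomial.coeff q) x = (\<Prod>y\<in>S. x - y)" for x
    using deg by (simp add: pval_coeff q_def poly_prod)
  ultimately show thesis using that by blast
qed

lemma pval_factor:
  assumes "finite S" "card S = n" "\<And>y. y \<in> S \<Longrightarrow> pval n a y = 0"
  shows "pval n a x = a n * (\<Prod>y\<in>S. x - y)"
proof -
  obtain b where b: "b n = 1" "\<And>x. pval n b x = (\<Prod>y\<in>S. x - y)"
    using prod_linear_coeff[OF assms(1)] assms(2) by auto
  define P :: "(nat \<Rightarrow> real) \<Rightarrow> real poly" where "P u = (\<Sum>j\<le>n. Polynomial.monom (u j) j)" for u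
  have coeff: "Polynomial.coeff (P u) i = (if i \<le> n then u i else 0)" for u i
    by (simp add: P_def coeff_sum if_distrib cong: if_cong)
  have deg: "Polynomial.degree (P u) \<le> n" for u
    by (rule degree_le) (simp add: coeff)
  have poly: "poly (P u) x = pval n u x" for u x
    by (simp add: P_def pval_def poly_sum poly_monom)
  have "P a = Polynomial.smult (a n) (P b)"
  proof (rule poly_eqI_degree_lead_coeff[where A = S and n = n])
    show "poly (P a) y = poly (Polynomial.smult (a n) (P b)) y" if "y \<in> S" for y
      using that assms(1,3) b(2) by (auto simp: poly prod_zero_iff)
    show "Polynomial.degree (Polynomial.smult (a n) (P b)) \<le> n"
      using deg[of b] by (meson degree_smult_le le_trans)
  qed (use assms deg coeff b in auto)
  then have "poly (P a) x = a n * poly (P b) x" by simp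
  then show ?thesis by (simp add: poly b)
qed

definition moment :: "real set \<Rightarrow> (real \<Rightarrow> real) \<Rightarrow> nat \<Rightarrow> real" where
  "moment S w j = (\<Sum>x\<in>S. w x * x ^ j)"

lemma sum_moment: "(\<Sum>j\<le>n. a j * moment S w j) = (\<Sum>x\<in>S. w x * pval n a x)"
  unfolding moment_def pval_def sum_distrib_left
  by (subst sum.swap) (simp add: algebra_simps)

section \<open>Bordered determinants\<close>

definition bordered :: "nat \<Rightarrow> (nat \<Rightarrow> nat \<Rightarrow> real) \<Rightarrow> (nat \<Rightarrow> real) \<Rightarrow> real mat" where
  "bordered n L b = mat (Suc n) (Suc n) (\<lambda>(i, j). if i < n then L i j else b j)"

definition minor :: "nat \<Rightarrow> (nat \<Rightarrow> nat \<Rightarrow> real) \<Rightarrow> nat \<Rightarrow> real" where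
  "minor n L j = cofactor (bordered n L (\<lambda>_. 0)) n j"

lemma bordered_carrier [simp]: "bordered n L b \<in> carrier_mat (Suc n) (Suc n)"
  by (simp add: bordered_def)

lemma det_bordered: "det (bordered n L b) = (\<Sum>j\<le>n. b j * minor n L j)"
proof -
  have "cofactor (bordered n L b) n j = minor n L j" if "j \<le> n" for j
  proof -
    have "mat_delete (bordered n L b) n j = mat_delete (bordered n L (\<lambda>_. 0)) n j"
      using that by (intro eq_matI) (auto simp: mat_delete_def bordered_def)
    then show ?thesis by (simp add: minor_def cofactor_def)
  qed
  then show ?thesis
    using laplace_expansion_row[OF bordered_carrier, of n n L b]
    by (simp add: lessThan_Suc_atMost bordered_def)
qed

lemma det_bordered_row:
  assumes "i < n" shows "(\<Sum>j\<le>n. L i j * minor n L j) = 0"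
proof -
  have "det (bordered n L (L i)) = 0"
    by (rule det_identical_rows[of _ "Suc n" i n])
      (use assms in \<open>auto simp: bordered_def intro!: eq_vecI\<close>)
  then show ?thesis by (simp add: det_bordered)
qed

lemma det_bordered_nonzero:
  assumes indep: "\<And>v. (\<And>j. j \<le> n \<Longrightarrow> (\<Sum>i<n. v i * L i j) = 0) \<Longrightarrow> \<forall>i<n. v i = 0"
    and orth: "\<And>i. i < n \<Longrightarrow> (\<Sum>j\<le>n. b j * L i j) = 0"
    and nz: "\<exists>j\<le>n. b j \<noteq> 0"
  shows "det (bordered n L b) \<noteq> 0"
proof
  let ?T = "transpose_mat (bordered n L b)"
  assume "det (bordered n L b) = 0"
  then have "det ?T = 0" by (simp add: det_transpose[OF bordered_carrier])
  then obtain v where v: "v \<in> carrier_vec (Suc n)" "v \<noteq> 0\<^sub>v (Suc n)" "?T *\<^sub>v v = 0\<^sub>v (Suc n)"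
    using det_0_iff_vec_prod_zero[of ?T "Suc n"] by auto
  have eq: "(\<Sum>i<n. v $ i * L i j) + v $ n * b j = 0" if "j \<le> n" for j
  proof -
    have "(?T *\<^sub>v v) $ j = 0" using v(3) that by simp
    then show ?thesis
      using that v(1)
      by (simp add: bordered_def scalar_prod_def mult.commute lessThan_atLeast0)
  qed
  have "0 = (\<Sum>j\<le>n. b j * ((\<Sum>i<n. v $ i * L i j) + v $ n * b j))"
    by (simp add: eq)
  also have "\<dots> = (\<Sum>j\<le>n. b j * (\<Sum>i<n. v $ i * L i j)) + v $ n * (\<Sum>j\<le>n. (b j)\<^sup>2)"
    by (simp add: algebra_simps sum.distrib sum_distrib_left power2_eq_square)
  also have "(\<Sum>j\<le>n. b j * (\<Sum>i<n. v $ i * L i j)) = (\<Sum>i<n. v $ i * (\<Sum>j\<le>n. b j * L i j))"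
    unfolding sum_distrib_left by (subst sum.swap) (simp add: algebra_simps)
  also have "\<dots> = 0" by (simp add: orth)
  finally have "v $ n * (\<Sum>j\<le>n. (b j)\<^sup>2) = 0" by simp
  moreover have "(\<Sum>j\<le>n. (b j)\<^sup>2) \<noteq> 0"
    using nz by (auto simp: sum_nonneg_eq_0_iff)
  ultimately have vn: "v $ n = 0" by simp
  with eq have "\<forall>i<n. v $ i = 0" by (intro indep) auto
  with vn have "v = 0\<^sub>v (Suc n)"
    using v(1) by (intro eq_vecI) (auto simp: less_Suc_eq)
  with v(2) show False by contradiction
qed

lemma continuous_on_det_bordered:
  fixes L :: "real \<Rightarrow> nat \<Rightarrow> nat \<Rightarrow> real"
  assumes "\<And>i j. i < n \<Longrightarrow> continuous_on T (\<lambda>t. L t i j)" "\<And>j. continuous_on T (\<lambda>t. b t j)"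
  shows "continuous_on T (\<lambda>t. det (bordered n (L t) (b t)))"
proof -
  have "continuous_on T (\<lambda>t. bordered n (L t) (b t) $$ (i, p i))"
    if "p permutes {0..<Suc n}" "i < Suc n" for p i
  proof -
    have "p i < Suc n" using permutes_in_image[OF that(1), of i] that(2) by simp
    then show ?thesis using that(2) assms by (cases "i < n") (auto simp: bordered_def)
  qed
  then show ?thesis
    unfolding det_def'[OF bordered_carrier]
    by (intro continuous_intros) auto
qed

lemma nonvanishing_same_sign:
  fixes u :: "real \<Rightarrow> real"
  assumes "continuous_on {0..1} u" "\<And>t. t \<in> {0..1} \<Longrightarrow> u t \<noteq> 0" "0 < u 0"
  shows "0 < u 1"
proof (rule ccontr)
  assume "\<not> 0 < u 1"
  then obtain t where "0 \<le> t" "t \<le> 1" "u t = 0"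
    using IVT2'[of u 1 0 0] assms by auto
  then show False using assms(2) by auto
qed

text \<open>If \<open>f\<close> and \<open>g\<close> are positive equally often on a colour, then every member
  \<open>(1 - t) f - t g\<close> of the pencil changes sign there, weakly but not trivially.\<close>

lemma exchange_points:
  fixes f g :: "real \<Rightarrow> real"
  assumes S: "finite S" "a \<in> S" "b \<in> S" "a \<noteq> b"
    and f: "\<And>x. x \<in> S \<Longrightarrow> f x = 0 \<longleftrightarrow> x = a" and g: "\<And>x. x \<in> S \<Longrightarrow> g x = 0 \<longleftrightarrow> x = b"
    and card: "card {x\<in>S. 0 < f x} = card {x\<in>S. 0 < g x}"
  obtains x y where "x \<in> S" "y \<in> S" "0 \<le> f x" "g x \<le> 0" "f y \<le> 0" "0 \<le> g y"
    "0 < f x \<or> f y < 0" "g x < 0 \<or> 0 < g y"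
proof (cases "{x\<in>S. 0 < f x} = {x\<in>S. 0 < g x}")
  case True
  have "\<not> 0 < g a" "\<not> 0 < f b" using True S f g by force+
  then have "g a < 0" "f b < 0" using S f g by (force simp: not_less order_le_less)+
  moreover have "f a = 0" "g b = 0" using S f g by auto
  ultimately show thesis using that[of a b] S by simp
next
  case False
  let ?F = "{x\<in>S. 0 < f x}" and ?G = "{x\<in>S. 0 < g x}"
  have "\<not> ?F \<subseteq> ?G" "\<not> ?G \<subseteq> ?F"
    using False S(1) card card_subset_eq[of ?F ?G] card_subset_eq[of ?G ?F] by auto
  then obtain x y where "x \<in> ?F" "x \<notin> ?G" "y \<in> ?G" "y \<notin> ?F" by blast
  then show thesis using that[of x y] by auto
qed

lemma pencil_weights:
  fixes f g :: "real \<Rightarrow> real"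
  assumes S: "finite S" "a \<in> S" "b \<in> S"
    and f: "\<And>x. x \<in> S \<Longrightarrow> f x = 0 \<longleftrightarrow> x = a" and g: "\<And>x. x \<in> S \<Longrightarrow> g x = 0 \<longleftrightarrow> x = b"
    and card: "card {x\<in>S. 0 < f x} = card {x\<in>S. 0 < g x}"
  shows "\<exists>w :: real \<Rightarrow> real \<Rightarrow> real. (\<forall>x. continuous_on {0..1} (\<lambda>t. w t x)) \<and>
    (\<forall>t\<in>{0..1}. (\<forall>x. 0 \<le> w t x) \<and> 0 < sum (w t) S \<and>
      (\<Sum>x\<in>S. w t x * ((1 - t) * f x - t * g x)) = 0)"
proof (cases "a = b")
  case True
  then have "f a = 0" "g a = 0" using S f g by auto
  then show ?thesis
    using S by (intro exI[of _ "\<lambda>t x. if x = a then 1 else 0"]) (simp add: if_distrib[of "\<lambda>u. u * _"] cong: if_cong)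
next
  case False
  obtain x y where xy: "x \<in> S" "y \<in> S" "0 \<le> f x" "g x \<le> 0" "f y \<le> 0" "0 \<le> g y"
    "0 < f x \<or> f y < 0" "g x < 0 \<or> 0 < g y"
    using exchange_points[OF S False f g card] by metis
  define h where "h t z = (1 - t) * f z - t * g z" for t z
  define w where "w t z = (if z = x then - h t y else 0) + (if z = y then h t x else 0)" for t z
  have hx: "0 \<le> h t x" and hy: "h t y \<le> 0" if "t \<in> {0..1}" for t
  proof -
    have "0 \<le> (1 - t) * f x" "t * g x \<le> 0" "(1 - t) * f y \<le> 0" "0 \<le> t * g y"
      using that xy by (auto intro: mult_nonneg_nonneg mult_nonneg_nonpos)
    then show "0 \<le> h t x" "h t y \<le> 0" by (auto simp: h_def)
  qed
  have pos: "0 < h t x - h t y" if t: "t \<in> {0..1}" for t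
  proof -
    have eq: "h t x - h t y = (1 - t) * (f x - f y) + t * (g y - g x)"
      by (simp add: h_def algebra_simps)
    have p: "0 < f x - f y" "0 < g y - g x" using xy by auto
    show ?thesis
    proof (cases "t = 0")
      case True
      with p eq show ?thesis by simp
    next
      case False
      with p t have "0 < t * (g y - g x)" "0 \<le> (1 - t) * (f x - f y)" by auto
      with eq show ?thesis by linarith
    qed
  qed
  have cont: "continuous_on {0..1} (\<lambda>t. w t z)" for z
    unfolding w_def h_def by (cases "z = x"; cases "z = y") (auto intro!: continuous_intros)
  have sum: "(\<Sum>z\<in>S. w t z * u z) = - h t y * u x + h t x * u y" for t u
    unfolding w_def using S xy
    by (simp add: distrib_right sum.distrib if_distrib[of "\<lambda>u. u * _"] cong: if_cong)
  have "sum (w t) S = h t x - h t y" for t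
    using sum[of t "\<lambda>_. 1"] by simp
  moreover have "(\<Sum>z\<in>S. w t z * ((1 - t) * f z - t * g z)) = 0" for t
    using sum[of t "h t"] by (simp add: h_def[abs_def] algebra_simps)
  moreover have "0 \<le> w t z" if "t \<in> {0..1}" for t z
    using hx[OF that] hy[OF that] by (simp add: w_def)
  ultimately show ?thesis using pos cont by (intro exI[of _ w]) auto
qed

section \<open>Oriented transversals of separated colours\<close>

locale separated_colors =
  fixes n :: nat and c :: "nat \<Rightarrow> real set"
  assumes finite_color: "i < n \<Longrightarrow> finite (c i)"
    and disjoint: "i < n \<Longrightarrow> j < n \<Longrightarrow> i \<noteq> j \<Longrightarrow> c i \<inter> c j = {}"
    and sep: "A \<subseteq> {..<n} \<Longrightarrow>
      \<exists>a. \<forall>i<n. \<forall>x\<in>c i. if i \<in> A then 0 < pval n a x else pval n a x < 0"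
begin

definition weights :: "(nat \<Rightarrow> real \<Rightarrow> real) \<Rightarrow> bool" where
  "weights w \<longleftrightarrow> (\<forall>i<n. (\<forall>x\<in>c i. 0 \<le> w i x) \<and> 0 < sum (w i) (c i))"

definition annihilates :: "(nat \<Rightarrow> real \<Rightarrow> real) \<Rightarrow> (nat \<Rightarrow> real) \<Rightarrow> bool" where
  "annihilates w b \<longleftrightarrow> (\<forall>i<n. (\<Sum>x\<in>c i. w i x * pval n b x) = 0)"

definition dt :: "(nat \<Rightarrow> real \<Rightarrow> real) \<Rightarrow> (nat \<Rightarrow> real) \<Rightarrow> real" where
  "dt w b = det (bordered n (\<lambda>i. moment (c i) (w i)) b)"

lemma weighted_sum_pos:
  assumes "weights w" "i < n" "\<forall>x\<in>c i. 0 < u x"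
  shows "0 < (\<Sum>x\<in>c i. w i x * u x)"
proof -
  have "\<exists>x\<in>c i. 0 < w i x"
    using assms(1,2) unfolding weights_def by (metis not_less sum_nonpos)
  then obtain x where x: "x \<in> c i" "0 < w i x" by blast
  have "0 < w i x * u x" using x assms(3) by simp
  moreover have "0 \<le> w i y * u y" if "y \<in> c i" for y
    using that assms by (auto simp: weights_def less_imp_le)
  ultimately show ?thesis
    using sum_pos2[OF finite_color[OF assms(2)] x(1), of "\<lambda>x. w i x * u x"] by simp
qed

lemma moments_independent:
  assumes w: "weights w"
    and v: "\<And>j. j \<le> n \<Longrightarrow> (\<Sum>i<n. v i * moment (c i) (w i) j) = 0"
  shows "\<forall>i<n. v i = 0"
proof -
  obtain a where a: "\<forall>i<n. \<forall>x\<in>c i. if i \<in> {i. i < n \<and> 0 < v i} then 0 < pval n a x else pval n a x < 0"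
    using sep[of "{i. i < n \<and> 0 < v i}"] by auto
  define s where "s i = (\<Sum>x\<in>c i. w i x * pval n a x)" for i
  have "(\<Sum>i<n. v i * s i) = (\<Sum>i<n. v i * (\<Sum>j\<le>n. a j * moment (c i) (w i) j))"
    by (simp add: s_def sum_moment)
  also have "\<dots> = (\<Sum>j\<le>n. a j * (\<Sum>i<n. v i * moment (c i) (w i) j))"
    unfolding sum_distrib_left by (subst sum.swap) (simp add: algebra_simps)
  also have "\<dots> = 0" by (simp add: v)
  finally have zero: "(\<Sum>i<n. v i * s i) = 0" .
  have pos: "0 < s i" if "i < n" "0 < v i" for i
    unfolding s_def using that a by (intro weighted_sum_pos[OF w]) auto
  have neg: "s i < 0" if "i < n" "\<not> 0 < v i" for i
    using weighted_sum_pos[OF w, of i "\<lambda>x. - pval n a x"] that a by (auto simp: s_def sum_negf)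
  have nonneg: "0 \<le> v i * s i" if "i < n" for i
    using pos[OF that] neg[OF that] by (cases "0 < v i") (auto intro: mult_nonpos_nonpos)
  have "\<forall>i\<in>{..<n}. v i * s i = 0"
    using zero nonneg by (subst sum_nonneg_eq_0_iff[symmetric]) auto
  with pos neg show ?thesis by (metis lessThan_iff less_irrefl mult_eq_0_iff)
qed

lemma dt_nonzero:
  assumes "weights w" "annihilates w b" "\<exists>j\<le>n. b j \<noteq> 0"
  shows "dt w b \<noteq> 0"
  unfolding dt_def
proof (rule det_bordered_nonzero)
  show "\<forall>i<n. v i = 0" if "\<And>j. j \<le> n \<Longrightarrow> (\<Sum>i<n. v i * moment (c i) (w i) j) = 0" for v
    using moments_independent[OF assms(1) that] .
  show "(\<Sum>j\<le>n. b j * moment (c i) (w i) j) = 0" if "i < n" for i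
    using assms(2) that by (simp add: sum_moment annihilates_def)
qed fact

lemma dt_homotopy:
  fixes w :: "real \<Rightarrow> nat \<Rightarrow> real \<Rightarrow> real"
  assumes w: "\<And>t. t \<in> {0..1} \<Longrightarrow> weights (w t)" "\<And>t. t \<in> {0..1} \<Longrightarrow> annihilates (w t) (b t)"
    and nz: "\<And>t. t \<in> {0..1} \<Longrightarrow> \<exists>j\<le>n. b t j \<noteq> 0"
    and cont: "\<And>i x. i < n \<Longrightarrow> continuous_on {0..1} (\<lambda>t. w t i x)"
      "\<And>j. continuous_on {0..1} (\<lambda>t. b t j)"
    and pos: "0 < dt (w 0) (b 0)"
  shows "0 < dt (w 1) (b 1)"
proof (rule nonvanishing_same_sign[of "\<lambda>t. dt (w t) (b t)"])
  show "continuous_on {0..1} (\<lambda>t. dt (w t) (b t))"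
    unfolding dt_def moment_def
    by (intro continuous_on_det_bordered continuous_intros cont)
qed (use dt_nonzero w nz pos in auto)

lemma dt_same_sign:
  assumes w: "weights w" "annihilates w b" and w': "weights w'" "annihilates w' b"
    and nz: "\<exists>j\<le>n. b j \<noteq> 0" and pos: "0 < dt w b"
  shows "0 < dt w' b"
proof -
  define W where "W t i x = (1 - t) * w i x + t * w' i x" for t i x
  have [simp]: "W 0 = w" "W 1 = w'" by (simp_all add: W_def fun_eq_iff)
  have "weights (W t)" if t: "t \<in> {0..1}" for t
    unfolding weights_def
  proof (intro allI impI conjI ballI)
    fix i assume i: "i < n"
    show "0 \<le> W t i x" if "x \<in> c i" for x
      using t i w w' that by (auto simp: W_def weights_def)
    have s: "0 < sum (w i) (c i)" "0 < sum (w' i) (c i)"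
      using i w w' by (auto simp: weights_def)
    have "sum (W t i) (c i) = (1 - t) * sum (w i) (c i) + t * sum (w' i) (c i)"
      by (simp add: W_def sum.distrib sum_distrib_left)
    moreover have "0 < \<dots>"
    proof (cases "t = 0")
      case False
      with t s have "0 < t * sum (w' i) (c i)" "0 \<le> (1 - t) * sum (w i) (c i)" by auto
      then show ?thesis by linarith
    qed (use s in simp)
    ultimately show "0 < sum (W t i) (c i)" by simp
  qed
  moreover have "annihilates (W t) b" for t
    using w(2) w'(2) unfolding annihilates_def W_def
    by (simp add: distrib_right sum.distrib mult.assoc flip: sum_distrib_left)
  ultimately have "0 < dt (W 1) b"
    by (intro dt_homotopy[of W "\<lambda>_. b"] nz) (auto simp: pos W_def intro!: continuous_intros)
  then show ?thesis by simp
qed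

definition point_weights :: "(nat \<Rightarrow> real) \<Rightarrow> nat \<Rightarrow> real \<Rightarrow> real" where
  "point_weights p i x = (if x = p i then 1 else 0)"

text \<open>Coefficients of the polynomial \<open>x \<mapsto> det (p\<^sub>i\<^sup>j; x\<^sup>j)\<close>: it vanishes on the transversal, and its sign records
  the order in which the transversal visits the colours.\<close>

definition orient :: "(nat \<Rightarrow> real) \<Rightarrow> nat \<Rightarrow> real" where
  "orient p = minor n (\<lambda>i. moment (c i) (point_weights p i))"

context
  fixes p assumes p: "p \<in> Pi\<^sub>E {..<n} c"
begin

lemma transversal_mem: "i < n \<Longrightarrow> p i \<in> c i"
  using p by auto

lemma transversal_inj: "inj_on p {..<n}"
proof (rule inj_onI)
  fix i j assume "i \<in> {..<n}" "j \<in> {..<n}" "p i = p j"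
  then show "i = j"
    using transversal_mem[of i] transversal_mem[of j] disjoint[of i j] by fastforce
qed

lemma sum_point_weights: "i < n \<Longrightarrow> (\<Sum>x\<in>c i. point_weights p i x * u x) = u (p i)"
  using finite_color[of i] transversal_mem[of i]
  by (simp add: point_weights_def if_distrib[of "\<lambda>u. u * _"] cong: if_cong)

lemma weights_point_weights: "weights (point_weights p)"
  using sum_point_weights[where u = "\<lambda>_. 1"] by (auto simp: weights_def point_weights_def)

lemma annihilates_point_weights:
  "annihilates (point_weights p) b \<longleftrightarrow> (\<forall>i<n. pval n b (p i) = 0)"
  by (auto simp: annihilates_def sum_point_weights)

lemma dt_point_weights: "dt (point_weights p) b = (\<Sum>j\<le>n. b j * orient p j)"
  by (simp add: dt_def orient_def det_bordered)

lemma annihilates_orient: "annihilates (point_weights p) (orient p)"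
  unfolding annihilates_def sum_moment[symmetric] orient_def
  using det_bordered_row[of _ n "\<lambda>i. moment (c i) (point_weights p i)"]
  by (simp add: mult.commute)

lemma pval_orient:
  "pval n (orient p) x = orient p n * (\<Prod>y\<in>p ` {..<n}. x - y)"
  using annihilates_orient card_image[OF transversal_inj]
  by (intro pval_factor) (auto simp: annihilates_point_weights)

lemma orient_nonzero: "\<exists>j\<le>n. orient p j \<noteq> 0"
proof -
  obtain b where b: "b n = 1" "\<And>x. pval n b x = (\<Prod>y\<in>p ` {..<n}. x - y)"
    using prod_linear_coeff[of "p ` {..<n}"] card_image[OF transversal_inj] by auto
  have "annihilates (point_weights p) b"
    by (auto simp: annihilates_point_weights b prod_zero_iff)
  then have "dt (point_weights p) b \<noteq> 0"
    using b(1) by (intro dt_nonzero weights_point_weights) (auto intro: exI[of _ n])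
  then obtain j where "j \<in> {..n}" "b j * orient p j \<noteq> 0"
    unfolding dt_point_weights by (rule sum.not_neutral_contains_not_neutral)
  then show ?thesis by auto
qed

lemma dt_orient_pos: "0 < dt (point_weights p) (orient p)"
proof -
  obtain j where j: "j \<le> n" "orient p j \<noteq> 0" using orient_nonzero by blast
  then show ?thesis
    unfolding dt_point_weights by (intro sum_pos2[of _ j]) (auto simp: zero_less_mult_iff)
qed

lemma orient_lead_nonzero: "orient p n \<noteq> 0"
proof
  assume "orient p n = 0"
  then have "pval n (orient p) x = 0" for x by (simp add: pval_orient)
  then have "poly (\<Sum>j\<le>n. Polynomial.monom (orient p j) j) x = 0" for x
    by (simp add: pval_def poly_sum poly_monom)
  then have "(\<Sum>j\<le>n. Polynomial.monom (orient p j) j) = 0"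
    using poly_all_0_iff_0 by blast
  moreover have "Polynomial.coeff (\<Sum>j\<le>n. Polynomial.monom (orient p j) j) i = orient p i"
    if "i \<le> n" for i
    using that by (simp add: coeff_sum)
  ultimately have "orient p i = 0" if "i \<le> n" for i
    using that by (metis coeff_0)
  then show False using orient_nonzero by blast
qed

lemma pval_orient_eq_0_iff:
  assumes "i < n" "x \<in> c i" shows "pval n (orient p) x = 0 \<longleftrightarrow> x = p i"
proof -
  have "x = p i" if "j < n" "x = p j" for j
    using that assms transversal_mem[of j] disjoint[of i j] by fastforce
  then show ?thesis
    using assms by (auto simp: pval_orient orient_lead_nonzero prod_zero_iff)
qed

lemma card_positive_negative:
  assumes "i < n"
  shows "card {x\<in>c i. 0 < pval n (orient p) x} + card {x\<in>c i. pval n (orient p) x < 0} + 1 = card (c i)"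
proof -
  let ?P = "{x\<in>c i. 0 < pval n (orient p) x}" and ?N = "{x\<in>c i. pval n (orient p) x < 0}"
  have "c i = insert (p i) (?P \<union> ?N)"
    using assms transversal_mem[of i] pval_orient_eq_0_iff[OF assms] by force
  moreover have "p i \<notin> ?P \<union> ?N"
    using assms transversal_mem[of i] pval_orient_eq_0_iff[OF assms, of "p i"] by auto
  moreover have "finite ?P" "finite ?N" using finite_color[OF assms] by auto
  moreover have "?P \<inter> ?N = {}" by auto
  ultimately show ?thesis by (metis (no_types, lifting) Suc_eq_plus1 card_Un_disjoint card_insert_disjoint finite_Un)
qed

lemma balanced_iff:
  assumes "i < n"
  shows "card {x\<in>c i. 0 < (\<Prod>y\<in>p ` {..<n}. y - x)} = card {x\<in>c i. (\<Prod>y\<in>p ` {..<n}. y - x) < 0} \<longleftrightarrow>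
    2 * card {x\<in>c i. 0 < pval n (orient p) x} + 1 = card (c i)"
proof -
  define k where "k = orient p n * (- 1) ^ n"
  have k: "k \<noteq> 0" using orient_lead_nonzero by (simp add: k_def)
  have eq: "pval n (orient p) x = k * (\<Prod>y\<in>p ` {..<n}. y - x)" for x
  proof -
    have "(\<Prod>y\<in>p ` {..<n}. x - y) = (\<Prod>y\<in>p ` {..<n}. (- 1) * (y - x))" by simp
    also have "\<dots> = (- 1) ^ n * (\<Prod>y\<in>p ` {..<n}. y - x)"
      by (subst prod.distrib) (simp add: card_image[OF transversal_inj])
    finally show ?thesis by (simp add: pval_orient k_def)
  qed
  consider "0 < k" | "k < 0" using k by linarith
  then have "card {x\<in>c i. 0 < (\<Prod>y\<in>p ` {..<n}. y - x)} = card {x\<in>c i. (\<Prod>y\<in>p ` {..<n}. y - x) < 0} \<longleftrightarrow>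
    card {x\<in>c i. 0 < pval n (orient p) x} = card {x\<in>c i. pval n (orient p) x < 0}"
    by cases (auto simp: eq zero_less_mult_iff mult_less_0_iff)
  then show ?thesis using card_positive_negative[OF assms] by linarith
qed

end

lemma positive_count_inj:
  assumes p: "p \<in> Pi\<^sub>E {..<n} c" and q: "q \<in> Pi\<^sub>E {..<n} c"
    and card: "\<And>i. i < n \<Longrightarrow> card {x\<in>c i. 0 < pval n (orient p) x} = card {x\<in>c i. 0 < pval n (orient q) x}"
  shows "p = q"
proof (rule ccontr)
  assume "p \<noteq> q"
  then obtain i0 where i0: "i0 < n" "p i0 \<noteq> q i0"
    using PiE_ext[OF p q] by auto
  define b where "b t j = (1 - t) * orient p j - t * orient q j" for t j
  have pval_b: "pval n (b t) x = (1 - t) * pval n (orient p) x - t * pval n (orient q) x" for t x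
    by (simp add: b_def pval_def sum_subtractf sum_distrib_left left_diff_distrib mult.assoc)
  define good where "good i w \<longleftrightarrow> (\<forall>x. continuous_on {0..1} (\<lambda>t. w t x)) \<and>
      (\<forall>t\<in>{0..1}. (\<forall>x. 0 \<le> w t x) \<and> 0 < sum (w t) (c i) \<and> (\<Sum>x\<in>c i. w t x * pval n (b t) x) = 0)"
    for i and w :: "real \<Rightarrow> real \<Rightarrow> real"
  have "\<exists>w. good i w" if "i < n" for i
    unfolding pval_b good_def
    using that finite_color transversal_mem[OF p] transversal_mem[OF q] card
      pval_orient_eq_0_iff[OF p] pval_orient_eq_0_iff[OF q]
    by (intro pencil_weights) auto
  then have "\<forall>i. \<exists>w. i < n \<longrightarrow> good i w" by blast
  then obtain W where W: "\<And>i. i < n \<Longrightarrow> good i (W i)" by metis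
  define w where "w t i = W i t" for t i
  \<comment> \<open>Three homotopies lead from \<open>(p, orient p)\<close> to \<open>(q, - orient q)\<close>: move the weights with the
    polynomial fixed, run through the pencil, move the weights again.\<close>
  have w: "weights (w t)" "annihilates (w t) (b t)" if "t \<in> {0..1}" for t
    using W that by (auto simp: w_def good_def weights_def annihilates_def)
  have nz: "\<exists>j\<le>n. b t j \<noteq> 0" if t: "t \<in> {0..1}" for t
  proof (rule ccontr)
    assume "\<not> ?thesis"
    then have "pval n (b t) x = 0" for x by (simp add: pval_def)
    then have eq: "(1 - t) * pval n (orient p) x = t * pval n (orient q) x" for x
      by (simp add: pval_b)
    have "pval n (orient p) (p i0) = 0" "pval n (orient p) (q i0) \<noteq> 0"
      "pval n (orient q) (q i0) = 0" "pval n (orient q) (p i0) \<noteq> 0"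
      using i0 transversal_mem[OF p i0(1)] transversal_mem[OF q i0(1)]
      by (auto simp: pval_orient_eq_0_iff[OF p i0(1)] pval_orient_eq_0_iff[OF q i0(1)])
    then show False using eq[of "p i0"] eq[of "q i0"] by simp
  qed
  have b0: "b 0 = orient p" and b1: "b 1 = (\<lambda>j. - orient q j)" by (auto simp: b_def)
  have "0 < dt (w 0) (b 0)"
    using dt_same_sign[OF weights_point_weights[OF p] annihilates_orient[OF p] _ _
        orient_nonzero[OF p] dt_orient_pos[OF p], of "w 0"] w[of 0] by (simp add: b0)
  then have "0 < dt (w 1) (b 1)"
    by (intro dt_homotopy[of w b] w nz) (use W in \<open>auto simp: w_def b_def good_def intro!: continuous_intros\<close>)
  moreover have "annihilates (point_weights q) (b 1)"
    using annihilates_orient[OF q] by (simp add: annihilates_point_weights[OF q] b1 pval_def sum_negf)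
  ultimately have "0 < dt (point_weights q) (b 1)"
    using w[of 1] nz[of 1] weights_point_weights[OF q] dt_same_sign[of "w 1" "b 1"] by simp
  also have "dt (point_weights q) (b 1) = - dt (point_weights q) (orient q)"
    by (simp add: dt_point_weights[OF q] b1 sum_negf)
  finally show False using dt_orient_pos[OF q] by simp
qed

lemma ex_positive_count:
  assumes "\<And>i. i < n \<Longrightarrow> m i < card (c i)"
  shows "\<exists>p \<in> Pi\<^sub>E {..<n} c. \<forall>i<n. card {x\<in>c i. 0 < pval n (orient p) x} = m i"
proof -
  define \<Phi> where "\<Phi> p = (\<lambda>i\<in>{..<n}. card {x\<in>c i. 0 < pval n (orient p) x})" for p
  let ?B = "Pi\<^sub>E {..<n} (\<lambda>i. {..<card (c i)})"
  have inj: "inj_on \<Phi> (Pi\<^sub>E {..<n} c)"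
  proof (rule inj_onI)
    fix p q assume *: "p \<in> Pi\<^sub>E {..<n} c" "q \<in> Pi\<^sub>E {..<n} c" "\<Phi> p = \<Phi> q"
    show "p = q"
    proof (rule positive_count_inj[OF *(1,2)])
      show "card {x\<in>c i. 0 < pval n (orient p) x} = card {x\<in>c i. 0 < pval n (orient q) x}"
        if "i < n" for i
        using fun_cong[OF *(3), of i] that by (simp add: \<Phi>_def)
    qed
  qed
  have "\<Phi> ` Pi\<^sub>E {..<n} c \<subseteq> ?B"
  proof (intro image_subsetI PiE_I)
    fix p i assume "p \<in> Pi\<^sub>E {..<n} c" "i \<in> {..<n}"
    then show "\<Phi> p i \<in> {..<card (c i)}"
      using card_positive_negative[of p i] by (simp add: \<Phi>_def)
  qed (simp add: \<Phi>_def)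
  moreover have "card (\<Phi> ` Pi\<^sub>E {..<n} c) = card ?B"
    by (simp add: card_image[OF inj] card_PiE)
  ultimately have surj: "\<Phi> ` Pi\<^sub>E {..<n} c = ?B"
    by (intro card_subset_eq) (auto intro: finite_PiE)
  have "restrict m {..<n} \<in> ?B" using assms by auto
  then obtain p where p: "p \<in> Pi\<^sub>E {..<n} c" "\<Phi> p = restrict m {..<n}"
    using surj by (metis (no_types, lifting) imageE)
  have "card {x\<in>c i. 0 < pval n (orient p) x} = m i" if "i < n" for i
    using fun_cong[OF p(2), of i] that by (simp add: \<Phi>_def)
  with p(1) show ?thesis by blast
qed

lemma transversal_of_set:
  assumes "finite Q" "card Q = n" "\<And>i. i < n \<Longrightarrow> c i \<inter> Q \<noteq> {}"
  obtains p where "p \<in> Pi\<^sub>E {..<n} c" "Q = p ` {..<n}"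
proof -
  have "\<forall>i. \<exists>y. i < n \<longrightarrow> y \<in> c i \<inter> Q" using assms(3) by blast
  then obtain r where r: "\<And>i. i < n \<Longrightarrow> r i \<in> c i \<inter> Q" by metis
  define p where "p = restrict r {..<n}"
  have p: "p \<in> Pi\<^sub>E {..<n} c" using r by (auto simp: p_def)
  have "p ` {..<n} \<subseteq> Q" using r by (auto simp: p_def)
  moreover have "card (p ` {..<n}) = card Q"
    using card_image[OF transversal_inj[OF p]] assms(2) by simp
  ultimately have "Q = p ` {..<n}" using assms(1) card_subset_eq by metis
  with p show thesis using that by blast
qed

end

lemma separated_colors_if_separable:
  assumes C: "necklace C" "separable n C" and c: "bij_betw c {..<n} C"
  shows "separated_colors n c"
proof
  have mem: "c i \<in> C" if "i < n" for i using c that by (auto simp: bij_betw_def)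
  show "finite (c i)" if "i < n" for i
    using C(1) mem[OF that] by (auto simp: necklace_def)
  show "c i \<inter> c j = {}" if "i < n" "j < n" "i \<noteq> j" for i j
  proof -
    have "c i \<noteq> c j" using c that by (auto simp: bij_betw_def inj_on_def)
    then show ?thesis
      using C(1) mem that by (auto simp: necklace_def pairwise_def disjnt_def)
  qed
  show "\<exists>a. \<forall>i<n. \<forall>x\<in>c i. if i \<in> A then 0 < pval n a x else pval n a x < 0"
    if A: "A \<subseteq> {..<n}" for A
  proof -
    have "c ` A \<subseteq> C" using A mem by auto
    with C(2) obtain S where S: "finite S" "card S = n"
      "\<forall>x\<in>\<Union>(c ` A). 0 < (\<Prod>y\<in>S. y - x)" "\<forall>x\<in>\<Union>(C - c ` A). (\<Prod>y\<in>S. y - x) < 0"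
      by (rule separable_imp_sign)
    obtain b where b: "b n = 1" "\<And>x. pval n b x = (\<Prod>y\<in>S. x - y)"
      using prod_linear_coeff[OF S(1)] unfolding S(2) by auto
    have eq: "pval n (\<lambda>j. (- 1) ^ n * b j) x = (\<Prod>y\<in>S. y - x)" for x
    proof -
      have "(\<Prod>y\<in>S. y - x) = (\<Prod>y\<in>S. (- 1) * (x - y))" by simp
      also have "\<dots> = (- 1) ^ n * pval n b x"
        by (subst prod.distrib) (simp add: S(2) b)
      finally show ?thesis by (simp add: pval_def sum_distrib_left mult.assoc)
    qed
    have "c i \<in> C - c ` A" if "i < n" "i \<notin> A" for i
      using c that A mem[OF that(1)] unfolding bij_betw_def inj_on_def by blast
    then have "\<forall>x\<in>c i. (\<Prod>y\<in>S. y - x) < 0" if "i < n" "i \<notin> A" for i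
      using S(4) that by blast
    then show ?thesis
      using S(3) by (intro exI[of _ "\<lambda>j. (- 1) ^ n * b j"]) (auto simp: eq)
  qed
qed

theorem theorem7:
  fixes C :: "real set set" and n :: nat
  assumes "necklace C"
    and "finite C" and "card C = n"
    and "separable n C"
    and "\<forall>c\<in>C. odd (card c)"
  shows "\<exists>!Q. splitting_solution C Q"
proof -
  obtain c where c: "bij_betw c {..<n} C"
    using ex_bij_betw_nat_finite[OF assms(2)] assms(3) by (auto simp: lessThan_atLeast0)
  interpret separated_colors n c
    using assms(1,4) c by (rule separated_colors_if_separable)
  have C: "C = c ` {..<n}" using c by (auto simp: bij_betw_def)
  have odd: "odd (card (c i))" if "i < n" for i using assms(5) that by (auto simp: C)
  define m where "m i = card (c i) div 2" for i
  have m: "2 * m i + 1 = card (c i)" if "i < n" for i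
    using odd[OF that] by (simp add: m_def)
  have half: "2 * k + 1 = card (c i) \<longleftrightarrow> k = m i" if "i < n" for i k
    using m[OF that] by linarith
  have "m i < card (c i)" if "i < n" for i using m[OF that] by linarith
  then obtain p where p: "p \<in> Pi\<^sub>E {..<n} c" "\<forall>i<n. card {x\<in>c i. 0 < pval n (orient p) x} = m i"
    using ex_positive_count[of m] by blast
  have uniq: "q = p" if "q \<in> Pi\<^sub>E {..<n} c" "\<forall>i<n. card {x\<in>c i. 0 < pval n (orient q) x} = m i" for q
    using that p by (intro positive_count_inj) auto
  have sol: "splitting_solution C (q ` {..<n}) \<longleftrightarrow>
      (\<forall>i<n. card {x\<in>c i. 0 < pval n (orient q) x} = m i)" if q: "q \<in> Pi\<^sub>E {..<n} c" for q
  proof -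
    have "splitting_solution C (q ` {..<n}) \<longleftrightarrow>
        (\<forall>i<n. 2 * card {x\<in>c i. 0 < pval n (orient q) x} + 1 = card (c i))"
      using card_image[OF transversal_inj[OF q]] assms(3) balanced_iff[OF q]
      by (auto simp: splitting_solution_iff C)
    also have "\<dots> \<longleftrightarrow> (\<forall>i<n. card {x\<in>c i. 0 < pval n (orient q) x} = m i)"
      using half by auto
    finally show ?thesis .
  qed
  show ?thesis
  proof (rule ex1I)
    show "splitting_solution C (p ` {..<n})" using sol p by blast
    fix Q assume Q: "splitting_solution C Q"
    then have fin: "finite Q" "card Q = n"
      and bal: "\<And>i. i < n \<Longrightarrow> card {x\<in>c i. 0 < (\<Prod>y\<in>Q. y - x)} = card {x\<in>c i. (\<Prod>y\<in>Q. y - x) < 0}"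
      using assms(3) by (auto simp: splitting_solution_iff C)
    have "c i \<inter> Q \<noteq> {}" if i: "i < n" for i
    proof
      assume empty: "c i \<inter> Q = {}"
      let ?P = "{x\<in>c i. 0 < (\<Prod>y\<in>Q. y - x)}" and ?N = "{x\<in>c i. (\<Prod>y\<in>Q. y - x) < 0}"
      have "(\<Prod>y\<in>Q. y - x) \<noteq> 0" if "x \<in> c i" for x
        using that empty fin by (auto simp: prod_zero_iff)
      then have "c i = ?P \<union> ?N" by (auto simp: linorder_neq_iff)
      moreover have "card (?P \<union> ?N) = card ?P + card ?N"
        using finite_color[OF i] by (intro card_Un_disjoint) auto
      ultimately have "even (card (c i))" using bal[OF i] by simp
      with odd[OF i] show False by contradiction
    qed
    then obtain q where q: "q \<in> Pi\<^sub>E {..<n} c" "Q = q ` {..<n}"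
      using transversal_of_set[OF fin] by blast
    then show "Q = p ` {..<n}" using uniq sol Q by blast
  qed
qed

end
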